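(* Let $RIC_n(p)=K(n,p)/K(n,p-1)$ be the Rees quotient semigroup defined in the context, where $1\le p\le n$. Then the rank of $RIC_n(p)$ is given by $$\mathrm{rank}\,RIC_n(p)=(n-1)\binom{n-2}{p-1}+\binom{n}{p}.$$
   Context: Let $n$ be a natural number and $[n]=\{1,2,\ldots,n\}$ with its usual order. $\mathcal{IC}_n$ is the monoid of all injective partial transformations $\alpha$ of $[n]$ (the empty map allowed) that are isotone ($x\le y$ implies $x\alpha\le y\alpha$ for all $x,y\in\mathrm{Dom}\,\alpha$) and order-decreasing ($x\alpha\le x$ for all $x\in \mathrm{Dom}\,\alpha$), maps being written on the right and composed left to right: $x(\alpha\beta)=(x\alpha)\beta$. For $1\le p\le n$, $K(n,p)=\{\alpha\in\mathcal{IC}_n:|\mathrm{Im}\,\alpha|\le p\}$ is a two-sided ideal of $\mathcal{IC}_n$ ($K(n,0)$ consists of the empty map). The Rees quotient $RIC_n(p)=K(n,p)/K(n,p-1)$ can be viewed as the set of elements of $\mathcal{IC}_n$ of height $|\mathrm{Im}\,\alpha|=p$ together with a zero $0$, where a product is $0$ whenever the product in $\mathcal{IC}_n$ has height less than $p$. The rank of a finite semigroup $S$ is $\min\{|A|: A\subseteq S,\ \langle A\rangle=S\}$, where $\langle A\rangle$ is the subsemigroup generated by $A$.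
   Formalization: For p = n the printed formula fails: RIC_n(n) = {id, 0} has rank 2 as a semigroup, while the formula gives 1. The formal theorem proves the printed formula for 1 ≤ p < n and, for p = n, the formula plus 1. *)

theory Defs
  imports Main
begin

section \<open>Generation and rank in semigroups given by a carrier and an operation\<close>

inductive_set subsemigroup_gen :: "('a \<Rightarrow> 'a \<Rightarrow> 'a) \<Rightarrow> 'a set \<Rightarrow> 'a set"
  for m :: "'a \<Rightarrow> 'a \<Rightarrow> 'a" and A :: "'a set"
where
  base: "a \<in> A \<Longrightarrow> a \<in> subsemigroup_gen m A"
| mult: "\<lbrakk>a \<in> subsemigroup_gen m A; b \<in> subsemigroup_gen m A\<rbrakk> \<Longrightarrow> m a b \<in> subsemigroup_gen m A"

definition semigroup_rank :: "'a set \<Rightarrow> ('a \<Rightarrow> 'a \<Rightarrow> 'a) \<Rightarrow> nat" where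
  "semigroup_rank S m =
     (LEAST k. \<exists>A. A \<subseteq> S \<and> finite A \<and> card A = k \<and> subsemigroup_gen m A = S)"

text \<open>For a finite semigroup the minimum is over a nonempty set of cardinalities.\<close>

lemma semigroup_rank_attained:
  assumes "finite S" "\<And>a b. a \<in> S \<Longrightarrow> b \<in> S \<Longrightarrow> m a b \<in> S"
  shows "\<exists>A. A \<subseteq> S \<and> finite A \<and> card A = semigroup_rank S m \<and> subsemigroup_gen m A = S"
proof -
  have "x \<in> S" if "x \<in> subsemigroup_gen m S" for x
    using that by (induction rule: subsemigroup_gen.induct) (auto intro: assms(2))
  then have "subsemigroup_gen m S = S"
    by (auto intro: subsemigroup_gen.base)
  with assms(1)
  have "\<exists>A. A \<subseteq> S \<and> finite A \<and> card A = card S \<and> subsemigroup_gen m A = S"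
    by blast
  then show ?thesis
    unfolding semigroup_rank_def by (rule LeastI)
qed

section \<open>Rees quotients\<close>

definition rees_cong :: "'a set \<Rightarrow> 'a set \<Rightarrow> ('a \<times> 'a) set" where
  "rees_cong S I = Id_on S \<union> I \<times> I"

definition rees_quotient :: "'a set \<Rightarrow> 'a set \<Rightarrow> 'a set set" where
  "rees_quotient S I = S // rees_cong S I"

text \<open>On classes the union below is the class of a product of representatives, see
  \<open>rees_mult_class\<close>.\<close>

definition rees_mult ::
    "'a set \<Rightarrow> 'a set \<Rightarrow> ('a \<Rightarrow> 'a \<Rightarrow> 'a) \<Rightarrow> 'a set \<Rightarrow> 'a set \<Rightarrow> 'a set" where
  "rees_mult S I m X Y = (\<Union>a\<in>X. \<Union>b\<in>Y. rees_cong S I `` {m a b})"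

lemma equiv_rees_cong: "I \<subseteq> S \<Longrightarrow> equiv S (rees_cong S I)"
  by (auto simp: rees_cong_def equiv_def refl_on_def sym_def trans_def)

lemma rees_mult_class:
  assumes I: "I \<subseteq> S"
    and ideal: "\<And>a b. a \<in> S \<Longrightarrow> b \<in> I \<Longrightarrow> m a b \<in> I" "\<And>a b. a \<in> I \<Longrightarrow> b \<in> S \<Longrightarrow> m a b \<in> I"
    and closed: "\<And>a b. a \<in> S \<Longrightarrow> b \<in> S \<Longrightarrow> m a b \<in> S"
    and ab: "a \<in> S" "b \<in> S"
  shows "rees_mult S I m (rees_cong S I `` {a}) (rees_cong S I `` {b}) = rees_cong S I `` {m a b}"
proof -
  note eq = equiv_rees_cong[OF I]
  have "rees_cong S I `` {m c d} = rees_cong S I `` {m a b}"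
    if "(a, c) \<in> rees_cong S I" "(b, d) \<in> rees_cong S I" for c d
  proof -
    have "(m a b, m c d) \<in> rees_cong S I"
      using that ideal closed ab I by (auto simp: rees_cong_def subset_iff)
    then show ?thesis
      using equiv_class_eq[OF eq] by metis
  qed
  moreover have "(a, a) \<in> rees_cong S I" "(b, b) \<in> rees_cong S I"
    using ab by (auto simp: rees_cong_def)
  ultimately show ?thesis
    unfolding rees_mult_def by blast
qed

section \<open>Order-decreasing isotone injective partial maps\<close>

text \<open>Partial maps are written on the right: \<open>\<alpha> \<cdot> \<beta>\<close> applies \<open>\<alpha>\<close> first.\<close>

definition pcomp :: "(nat \<rightharpoonup> nat) \<Rightarrow> (nat \<rightharpoonup> nat) \<Rightarrow> (nat \<rightharpoonup> nat)" where
  "pcomp \<alpha> \<beta> = \<beta> \<circ>\<^sub>m \<alpha>"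

definition IC :: "nat \<Rightarrow> (nat \<rightharpoonup> nat) set" where
  "IC n = {\<alpha>. dom \<alpha> \<subseteq> {1..n} \<and> ran \<alpha> \<subseteq> {1..n} \<and> inj_on \<alpha> (dom \<alpha>) \<and>
     (\<forall>x\<in>dom \<alpha>. \<forall>y\<in>dom \<alpha>. x \<le> y \<longrightarrow> the (\<alpha> x) \<le> the (\<alpha> y)) \<and>
     (\<forall>x\<in>dom \<alpha>. the (\<alpha> x) \<le> x)}"

definition K :: "nat \<Rightarrow> nat \<Rightarrow> (nat \<rightharpoonup> nat) set" where
  "K n p = {\<alpha> \<in> IC n. card (ran \<alpha>) \<le> p}"

definition RIC :: "nat \<Rightarrow> nat \<Rightarrow> (nat \<rightharpoonup> nat) set set" where
  "RIC n p = rees_quotient (K n p) (K n (p - 1))"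

definition RIC_mult ::
    "nat \<Rightarrow> nat \<Rightarrow> (nat \<rightharpoonup> nat) set \<Rightarrow> (nat \<rightharpoonup> nat) set \<Rightarrow> (nat \<rightharpoonup> nat) set" where
  "RIC_mult n p = rees_mult (K n p) (K n (p - 1)) pcomp"

lemma IC_iff:
  "\<alpha> \<in> IC n \<longleftrightarrow>
     (\<forall>x y. \<alpha> x = Some y \<longrightarrow> x \<in> {1..n}) \<and>
     (\<forall>x y. \<alpha> x = Some y \<longrightarrow> y \<in> {1..n}) \<and>
     (\<forall>x x' y. \<alpha> x = Some y \<longrightarrow> \<alpha> x' = Some y \<longrightarrow> x = x') \<and>
     (\<forall>x x' y y'. \<alpha> x = Some y \<longrightarrow> \<alpha> x' = Some y' \<longrightarrow> x \<le> x' \<longrightarrow> y \<le> y') \<and>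
     (\<forall>x y. \<alpha> x = Some y \<longrightarrow> y \<le> x)"
proof -
  have dom: "dom \<alpha> \<subseteq> {1..n} \<longleftrightarrow> (\<forall>x y. \<alpha> x = Some y \<longrightarrow> x \<in> {1..n})"
    unfolding dom_def by blast
  have ran: "ran \<alpha> \<subseteq> {1..n} \<longleftrightarrow> (\<forall>x y. \<alpha> x = Some y \<longrightarrow> y \<in> {1..n})"
    unfolding ran_def by blast
  have inj: "inj_on \<alpha> (dom \<alpha>) \<longleftrightarrow>
      (\<forall>x x' y. \<alpha> x = Some y \<longrightarrow> \<alpha> x' = Some y \<longrightarrow> x = x')"
    unfolding inj_on_def dom_def by force
  have mono: "(\<forall>x\<in>dom \<alpha>. \<forall>y\<in>dom \<alpha>. x \<le> y \<longrightarrow> the (\<alpha> x) \<le> the (\<alpha> y)) \<longleftrightarrow>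
      (\<forall>x x' y y'. \<alpha> x = Some y \<longrightarrow> \<alpha> x' = Some y' \<longrightarrow> x \<le> x' \<longrightarrow> y \<le> y')"
    unfolding dom_def by force
  have decr: "(\<forall>x\<in>dom \<alpha>. the (\<alpha> x) \<le> x) \<longleftrightarrow> (\<forall>x y. \<alpha> x = Some y \<longrightarrow> y \<le> x)"
    unfolding dom_def by force
  show ?thesis
    unfolding IC_def mem_Collect_eq dom ran inj mono decr by (rule refl)
qed

lemma pcomp_eq_Some: "pcomp \<alpha> \<beta> x = Some z \<longleftrightarrow> (\<exists>y. \<alpha> x = Some y \<and> \<beta> y = Some z)"
  by (auto simp: pcomp_def map_comp_def split: option.splits)

lemma pcomp_IC:
  assumes "\<alpha> \<in> IC n" "\<beta> \<in> IC n"
  shows "pcomp \<alpha> \<beta> \<in> IC n"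
proof -
  note a = assms(1)[unfolded IC_iff] and b = assms(2)[unfolded IC_iff]
  have "x \<in> {1..n}" "z \<in> {1..n}" "z \<le> x" if xz: "pcomp \<alpha> \<beta> x = Some z" for x z
  proof -
    obtain y where y: "\<alpha> x = Some y" "\<beta> y = Some z"
      using xz unfolding pcomp_eq_Some by blast
    show "x \<in> {1..n}" using a y(1) by blast
    show "z \<in> {1..n}" using b y(2) by blast
    have "y \<le> x" using a y(1) by blast
    moreover have "z \<le> y" using b y(2) by blast
    ultimately show "z \<le> x" by simp
  qed
  moreover have "x = x'" if xz: "pcomp \<alpha> \<beta> x = Some z" "pcomp \<alpha> \<beta> x' = Some z" for x x' z
  proof -
    obtain y y' where y: "\<alpha> x = Some y" "\<beta> y = Some z" "\<alpha> x' = Some y'" "\<beta> y' = Some z"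
      using xz unfolding pcomp_eq_Some by blast
    have "y = y'" using b y(2,4) by blast
    then show ?thesis using a y(1,3) by blast
  qed
  moreover have "z \<le> z'"
    if xz: "pcomp \<alpha> \<beta> x = Some z" "pcomp \<alpha> \<beta> x' = Some z'" "x \<le> x'" for x x' z z'
  proof -
    obtain y y' where y: "\<alpha> x = Some y" "\<beta> y = Some z" "\<alpha> x' = Some y'" "\<beta> y' = Some z'"
      using xz(1,2) unfolding pcomp_eq_Some by blast
    have "y \<le> y'" using a y(1,3) xz(3) by blast
    then show ?thesis using b y(2,4) by blast
  qed
  ultimately show ?thesis
    unfolding IC_iff by (intro conjI allI impI)
qed

lemma K_ideal:
  assumes "\<alpha> \<in> IC n" "\<beta> \<in> K n p"
  shows "pcomp \<alpha> \<beta> \<in> K n p" "pcomp \<beta> \<alpha> \<in> K n p"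
proof -
  have b: "\<beta> \<in> IC n" "card (ran \<beta>) \<le> p"
    using assms(2) by (auto simp: K_def)
  have "ran \<beta> \<subseteq> {1..n}"
    using b(1) by (simp add: IC_def)
  then have fin: "finite (ran \<beta>)"
    by (rule finite_subset) simp
  have "ran (pcomp \<alpha> \<beta>) \<subseteq> ran \<beta>"
    by (auto simp: ran_def pcomp_def map_comp_def split: option.splits)
  then have "card (ran (pcomp \<alpha> \<beta>)) \<le> p"
    using card_mono[OF fin] b(2) le_trans by blast
  then show "pcomp \<alpha> \<beta> \<in> K n p"
    using pcomp_IC[OF assms(1) b(1)] by (simp add: K_def)
  have "ran (pcomp \<beta> \<alpha>) \<subseteq> (\<lambda>x. the (\<alpha> x)) ` ran \<beta>"
    by (force simp: ran_def pcomp_def map_comp_def split: option.splits)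
  then have "card (ran (pcomp \<beta> \<alpha>)) \<le> card (ran \<beta>)"
    by (rule surj_card_le[OF fin])
  then show "pcomp \<beta> \<alpha> \<in> K n p"
    using pcomp_IC[OF b(1) assms(1)] b(2) by (simp add: K_def)
qed

lemma RIC_mult_class:
  assumes "\<alpha> \<in> K n p" "\<beta> \<in> K n p"
  shows "RIC_mult n p (rees_cong (K n p) (K n (p - 1)) `` {\<alpha>}) (rees_cong (K n p) (K n (p - 1)) `` {\<beta>})
           = rees_cong (K n p) (K n (p - 1)) `` {pcomp \<alpha> \<beta>}"
proof -
  have sub: "K n q \<subseteq> IC n" for q
    by (auto simp: K_def)
  show ?thesis
    unfolding RIC_mult_def
    by (rule rees_mult_class) (use assms sub K_ideal in \<open>auto simp: K_def\<close>)
qed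

end

theory Submission
  imports Defs
begin

text \<open>A map of height \<open>p\<close> is determined by its domain and its image, and the product of two such
  maps is nonzero iff the image of the first is the domain of the second. The total displacement
  \<open>\<Sum> (x - x\<alpha>)\<close> is additive on nonzero products and vanishes exactly on the partial identities,
  so maps of displacement at most \<open>1\<close> have only trivial factorizations and lie in every
  generating set. Conversely, lowering the least non-fixed point by one splits off a factor of
  displacement \<open>1\<close>, so these maps generate all maps of height \<open>p\<close>. The zero is a product of two
  distinct partial identities unless \<open>p = n\<close>, when it is an additional generator.\<close>

section \<open>Rank and irreducible elements\<close>

text \<open>A product equal to \<open>x\<close> has \<open>x\<close> as one of its factors, so
  tracing \<open>x\<close> back through its generation never leaves \<open>x\<close> and must end at
  a generator.\<close>

lemma irreducible_in_generating_set:
  assumes "x \<in> subsemigroup_gen m A"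
    and irr: "\<And>a b. a \<in> subsemigroup_gen m A \<Longrightarrow> b \<in> subsemigroup_gen m A \<Longrightarrow> m a b = x \<Longrightarrow>
      a = x \<or> b = x"
  shows "x \<in> A"
proof -
  \<comment> \<open>The equation stays inside the induction formula: in the product case one factor
    is again \<open>x\<close>, and its induction hypothesis applies.\<close>
  have "y = x \<Longrightarrow> x \<in> A" if "y \<in> subsemigroup_gen m A" for y
    using that by (induction rule: subsemigroup_gen.induct) (use irr in blast)+
  then show ?thesis
    using assms(1) by blast
qed

text \<open>Every generating set contains the irreducible elements, so a generating set
  \<open>G\<close> made of irreducibles is the least one under inclusion, hence also of least
  size.\<close>

lemma semigroup_rank_eq_card_irreducibles:
  assumes "G \<subseteq> S" "finite G" "subsemigroup_gen m G = S"
    and irr: "\<And>x a b. x \<in> G \<Longrightarrow> a \<in> S \<Longrightarrow> b \<in> S \<Longrightarrow> m a b = x \<Longrightarrow> a = x \<or> b = x"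
  shows "semigroup_rank S m = card G"
  unfolding semigroup_rank_def
proof (rule Least_equality)
  show "\<exists>A. A \<subseteq> S \<and> finite A \<and> card A = card G \<and> subsemigroup_gen m A = S"
    using assms by blast
next
  fix k
  assume "\<exists>A. A \<subseteq> S \<and> finite A \<and> card A = k \<and> subsemigroup_gen m A = S"
  then obtain A where A: "finite A" "card A = k" "subsemigroup_gen m A = S"
    by blast
  have "G \<subseteq> A"
  proof
    fix x assume "x \<in> G"
    with \<open>G \<subseteq> S\<close> show "x \<in> A"
      using irr by (intro irreducible_in_generating_set[of x m A]) (auto simp: A(3))
  qed
  then show "card G \<le> k"
    using A card_mono by blast
qed

section \<open>Maps of fixed height and their displacement\<close>

text \<open>For \<open>p \<ge> 1\<close> these maps are the nonzero elements of the Rees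
  quotient.\<close>

definition ICh :: "nat \<Rightarrow> nat \<Rightarrow> (nat \<rightharpoonup> nat) set" where
  "ICh n p = {\<alpha> \<in> IC n. card (ran \<alpha>) = p}"

text \<open>Truncated subtraction loses nothing on \<open>IC n\<close>, whose maps are
  order-decreasing.\<close>

definition disp :: "(nat \<rightharpoonup> nat) \<Rightarrow> nat" where
  "disp \<alpha> = (\<Sum>x\<in>dom \<alpha>. x - the (\<alpha> x))"

definition pid :: "nat set \<Rightarrow> (nat \<rightharpoonup> nat)" where
  "pid A = (\<lambda>x. if x \<in> A then Some x else None)"

text \<open>Meant for \<open>C\<close> avoiding both \<open>a\<close> and \<open>a - 1\<close>: a
  point \<open>a - 1\<close> in \<open>C\<close> would collide with the image of
  \<open>a\<close>.\<close>

definition lower :: "nat \<Rightarrow> nat set \<Rightarrow> (nat \<rightharpoonup> nat)" where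
  "lower a C = (pid C)(a \<mapsto> a - 1)"

lemma ran_conv_image_dom: "ran \<alpha> = (\<lambda>x. the (\<alpha> x)) ` dom \<alpha>"
  by (force simp: ran_def dom_def)

lemma IC_finite_dom: "\<alpha> \<in> IC n \<Longrightarrow> finite (dom \<alpha>)"
  unfolding IC_def using finite_subset by blast

lemma IC_inj_on_the: "\<alpha> \<in> IC n \<Longrightarrow> inj_on (\<lambda>x. the (\<alpha> x)) (dom \<alpha>)"
  unfolding IC_iff inj_on_def dom_def by auto

lemma IC_card_dom: "\<alpha> \<in> IC n \<Longrightarrow> card (dom \<alpha>) = card (ran \<alpha>)"
  unfolding ran_conv_image_dom by (simp add: card_image IC_inj_on_the)

lemma IC_strict_mono:
  assumes "\<alpha> \<in> IC n" "\<alpha> x = Some u" "\<alpha> y = Some v" "x < y"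
  shows "u < v"
proof -
  have "u \<le> v" "u \<noteq> v"
    using assms unfolding IC_iff by (metis less_imp_le, metis less_irrefl)
  then show ?thesis by simp
qed

text \<open>Strict monotonicity yields injectivity and isotonicity at once, so new maps need only
  this one check on pairs.\<close>

lemma IC_I:
  assumes "\<And>x y. \<alpha> x = Some y \<Longrightarrow> 1 \<le> y \<and> y \<le> x \<and> x \<le> n"
    and "\<And>x x' y y'. \<alpha> x = Some y \<Longrightarrow> \<alpha> x' = Some y' \<Longrightarrow> x < x' \<Longrightarrow> y < y'"
  shows "\<alpha> \<in> IC n"
  unfolding IC_iff
proof (intro conjI allI impI)
  fix x x' y assume "\<alpha> x = Some y" "\<alpha> x' = Some y"
  then show "x = x'"
    using assms(2)[of x y x' y] assms(2)[of x' y x y] by (metis less_irrefl nat_neq_iff)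
next
  fix x x' y y' assume "\<alpha> x = Some y" "\<alpha> x' = Some y'" "x \<le> x'"
  then show "y \<le> y'"
    using assms(2)[of x y x' y'] by (cases "x = x'") auto
qed (use assms(1) in \<open>force+\<close>)

section \<open>Partial identities and maps lowering a single point by one\<close>

lemma pid_eq_Some: "pid A x = Some y \<longleftrightarrow> x \<in> A \<and> y = x"
  by (auto simp: pid_def)

lemma dom_pid: "dom (pid A) = A"
  by (auto simp: dom_def pid_def)

lemma ran_pid: "ran (pid A) = A"
  by (auto simp: ran_def pid_def)

lemma pid_in_ICh: "A \<subseteq> {1..n} \<Longrightarrow> card A = p \<Longrightarrow> pid A \<in> ICh n p"
  unfolding ICh_def by (auto simp: ran_pid pid_eq_Some intro!: IC_I)

lemma disp_pid: "disp (pid A) = 0"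
  unfolding disp_def dom_pid by (simp add: pid_def)

lemma lower_eq_Some: "lower a C x = Some y \<longleftrightarrow> x = a \<and> y = a - 1 \<or> x \<noteq> a \<and> x \<in> C \<and> y = x"
  by (auto simp: lower_def pid_eq_Some)

lemma dom_lower: "dom (lower a C) = insert a C"
  by (simp add: lower_def dom_pid)

lemma ran_lower: "a \<notin> C \<Longrightarrow> ran (lower a C) = insert (a - 1) C"
  by (auto simp: ran_def lower_eq_Some)

lemma lower_in_ICh:
  assumes "a \<in> {2..n}" "C \<subseteq> {1..n} - {a - 1, a}" "card C = p - 1" "1 \<le> p"
  shows "lower a C \<in> ICh n p"
proof -
  have "lower a C \<in> IC n"
  proof (rule IC_I)
    fix x x' y y'
    assume *: "lower a C x = Some y" "lower a C x' = Some y'" "x < x'"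
    \<comment> \<open>The only critical pair is \<open>a - 1 < a\<close>: any other point of
      \<open>C\<close> below \<open>a\<close> is already below \<open>a - 1\<close>.\<close>
    have "x \<noteq> a - 1" if "x' = a"
      using * assms that by (auto simp: lower_eq_Some)
    then show "y < y'"
      using * by (auto simp: lower_eq_Some)
  qed (use assms in \<open>auto simp: lower_eq_Some\<close>)
  moreover have "finite C" "a - 1 \<notin> C" "a \<notin> C"
    using assms by (auto intro: finite_subset)
  ultimately show ?thesis
    using assms by (simp add: ICh_def ran_lower)
qed

lemma disp_lower:
  assumes "1 \<le> a" "a \<notin> C" "finite C"
  shows "disp (lower a C) = 1"
proof -
  have "(\<Sum>x\<in>C. x - the (lower a C x)) = 0"
    using assms by (auto simp: lower_def pid_def)
  then show ?thesis
    using assms by (simp add: disp_def dom_lower) (simp add: lower_def)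
qed

lemma disp_eq_0:
  assumes "\<alpha> \<in> IC n" "disp \<alpha> = 0"
  shows "\<alpha> = pid (dom \<alpha>)"
proof
  fix x
  show "\<alpha> x = pid (dom \<alpha>) x"
  proof (cases "\<alpha> x")
    case None
    then show ?thesis by (simp add: pid_def dom_def)
  next
    case (Some y)
    then have "x - y = 0"
      using assms IC_finite_dom[OF assms(1)] unfolding disp_def by force
    \<comment> \<open>A truncated difference of \<open>0\<close> gives only
      \<open>x \<le> y\<close>; the decreasing property supplies the converse.\<close>
    moreover have "y \<le> x"
      using assms(1) Some unfolding IC_iff by blast
    ultimately show ?thesis
      using Some by (auto simp: pid_def)
  qed
qed

section \<open>Nonzero products\<close>

text \<open>The product keeps height \<open>p\<close> only if all \<open>p\<close> points of
  \<open>dom \<alpha>\<close> survive, that is, if \<open>ran \<alpha>\<close> lies in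
  \<open>dom \<beta>\<close>; both sets have \<open>p\<close> elements, so inclusion is
  equality.\<close>

lemma pcomp_in_ICh_iff:
  assumes "\<alpha> \<in> ICh n p" "\<beta> \<in> ICh n p"
  shows "pcomp \<alpha> \<beta> \<in> ICh n p \<longleftrightarrow> ran \<alpha> = dom \<beta>"
proof -
  have a: "\<alpha> \<in> IC n" "card (ran \<alpha>) = p" "card (dom \<alpha>) = p"
    and b: "\<beta> \<in> IC n" "card (ran \<beta>) = p" "card (dom \<beta>) = p"
    using assms IC_card_dom by (auto simp: ICh_def)
  note c = pcomp_IC[OF a(1) b(1)]
  show ?thesis
  proof
    assume "pcomp \<alpha> \<beta> \<in> ICh n p"
    then have "card (dom (pcomp \<alpha> \<beta>)) = p"
      using IC_card_dom[OF c] by (simp add: ICh_def)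
    moreover have "dom (pcomp \<alpha> \<beta>) \<subseteq> dom \<alpha>"
      by (auto simp: dom_def pcomp_eq_Some)
    ultimately have eq: "dom (pcomp \<alpha> \<beta>) = dom \<alpha>"
      using card_subset_eq[OF IC_finite_dom[OF a(1)]] a(3) by simp
    have "ran \<alpha> \<subseteq> dom \<beta>"
    proof
      fix y assume "y \<in> ran \<alpha>"
      then obtain x where x: "\<alpha> x = Some y"
        by (auto simp: ran_def)
      then have "x \<in> dom (pcomp \<alpha> \<beta>)"
        using eq by auto
      then show "y \<in> dom \<beta>"
        using x by (auto simp: pcomp_eq_Some)
    qed
    then show "ran \<alpha> = dom \<beta>"
      using card_subset_eq[OF IC_finite_dom[OF b(1)]] a(2) b(3) by simp
  next
    assume eq: "ran \<alpha> = dom \<beta>"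
    have "ran (pcomp \<alpha> \<beta>) = ran \<beta>"
      using eq unfolding ran_def dom_def pcomp_eq_Some by blast
    then show "pcomp \<alpha> \<beta> \<in> ICh n p"
      using c b(2) by (simp add: ICh_def)
  qed
qed

text \<open>The displacement telescopes along \<open>x \<mapsto> y \<mapsto> z\<close>, once the sum
  for \<open>\<beta>\<close> is reindexed by the injection \<open>\<alpha>\<close>.\<close>

lemma disp_pcomp:
  assumes "\<alpha> \<in> IC n" "\<beta> \<in> IC n" "ran \<alpha> = dom \<beta>"
  shows "disp (pcomp \<alpha> \<beta>) = disp \<alpha> + disp \<beta>"
proof -
  have dom: "dom (pcomp \<alpha> \<beta>) = dom \<alpha>"
    using assms(3) by (fastforce simp: pcomp_eq_Some dom_def ran_def)
  have "disp \<beta> = (\<Sum>y\<in>(\<lambda>x. the (\<alpha> x)) ` dom \<alpha>. y - the (\<beta> y))"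
    using assms(3) by (simp add: disp_def ran_conv_image_dom)
  also have "\<dots> = (\<Sum>x\<in>dom \<alpha>. the (\<alpha> x) - the (\<beta> (the (\<alpha> x))))"
    by (simp add: sum.reindex IC_inj_on_the[OF assms(1)])
  finally have "disp \<alpha> + disp \<beta> =
      (\<Sum>x\<in>dom \<alpha>. (x - the (\<alpha> x)) + (the (\<alpha> x) - the (\<beta> (the (\<alpha> x)))))"
    by (simp add: disp_def sum.distrib)
  also have "\<dots> = (\<Sum>x\<in>dom \<alpha>. x - the (pcomp \<alpha> \<beta> x))"
  proof (rule sum.cong)
    fix x assume "x \<in> dom \<alpha>"
    then obtain z where z: "pcomp \<alpha> \<beta> x = Some z"
      using dom by blast
    then obtain y where y: "\<alpha> x = Some y" "\<beta> y = Some z"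
      unfolding pcomp_eq_Some by blast
    \<comment> \<open>Both inequalities are what makes \<open>(x - y) + (y - z) = x - z\<close>
      valid for truncated subtraction.\<close>
    have "y \<le> x" "z \<le> y"
      using assms(1,2) y unfolding IC_iff by blast+
    then show "x - the (\<alpha> x) + (the (\<alpha> x) - the (\<beta> (the (\<alpha> x)))) = x - the (pcomp \<alpha> \<beta> x)"
      using y z by simp
  qed simp
  finally show ?thesis
    by (simp add: disp_def dom)
qed

section \<open>Trivial factorizations, and splitting off a factor of displacement one\<close>

lemma pcomp_pid_left: "pcomp (pid (dom \<beta>)) \<beta> = \<beta>"
  by (auto simp: pcomp_def pid_def map_comp_def fun_eq_iff domIff)

lemma pcomp_pid_right: "pcomp \<alpha> (pid (ran \<alpha>)) = \<alpha>"
  by (auto simp: pcomp_def pid_def map_comp_def fun_eq_iff ran_def split: option.splits)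

text \<open>By additivity one factor has displacement \<open>0\<close>. It is then the partial
  identity on \<open>ran \<alpha> = dom \<beta>\<close>, which is neutral for the other
  factor.\<close>

lemma disp_le_1_irreducible:
  assumes "\<alpha> \<in> ICh n p" "\<beta> \<in> ICh n p" "pcomp \<alpha> \<beta> \<in> ICh n p" "disp (pcomp \<alpha> \<beta>) \<le> 1"
  shows "\<alpha> = pcomp \<alpha> \<beta> \<or> \<beta> = pcomp \<alpha> \<beta>"
proof -
  have eq: "ran \<alpha> = dom \<beta>"
    using assms pcomp_in_ICh_iff by blast
  have IC: "\<alpha> \<in> IC n" "\<beta> \<in> IC n"
    using assms by (auto simp: ICh_def)
  have "disp \<alpha> = 0 \<or> disp \<beta> = 0"
    using disp_pcomp[OF IC eq] assms(4) by linarith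
  then show ?thesis
  proof
    assume "disp \<alpha> = 0"
    then have "\<alpha> = pid (dom \<alpha>)"
      using disp_eq_0 IC by blast
    then have "\<alpha> = pid (dom \<beta>)"
      using eq ran_pid by metis
    then show ?thesis
      using pcomp_pid_left by metis
  next
    assume "disp \<beta> = 0"
    then have "\<beta> = pid (ran \<alpha>)"
      using disp_eq_0 IC eq by metis
    then show ?thesis
      using pcomp_pid_right by metis
  qed
qed

text \<open>Let \<open>a\<close> be the least moved point and \<open>b\<close> its image. The step
  from \<open>a\<close> to \<open>b\<close> is routed through \<open>a - 1\<close>:
  \<open>lower a C\<close> takes \<open>a\<close> there, and \<open>\<gamma>\<close> continues to
  \<open>b\<close> and acts as \<open>\<alpha>\<close> elsewhere.\<close>

lemma split_off_lower:
  assumes "\<alpha> \<in> ICh n p" "0 < disp \<alpha>" "1 \<le> p"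
  obtains a C \<gamma> where "a \<in> {2..n}" "C \<subseteq> {1..n} - {a - 1, a}" "card C = p - 1"
    "\<gamma> \<in> ICh n p" "ran (lower a C) = dom \<gamma>" "\<alpha> = pcomp (lower a C) \<gamma>"
proof -
  have IC: "\<alpha> \<in> IC n" and card_dom: "card (dom \<alpha>) = p"
    using assms IC_card_dom by (auto simp: ICh_def)
  note fin = IC_finite_dom[OF IC]
  define moved where "moved x \<longleftrightarrow> (\<exists>y. \<alpha> x = Some y \<and> y < x)" for x
  have "\<exists>x. moved x"
  proof (rule ccontr)
    assume "\<not> ?thesis"
    then have "disp \<alpha> = 0"
      unfolding disp_def moved_def by (force simp: dom_def not_less)
    then show False
      using assms by simp
  qed
  then obtain a where a: "moved a" "\<And>x. x < a \<Longrightarrow> \<not> moved x"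
    using exists_least_iff[of moved] by blast
  then obtain b where b: "\<alpha> a = Some b" "b < a"
    by (auto simp: moved_def)
  have bounds: "1 \<le> b" "a \<le> n"
    using IC b(1) unfolding IC_iff by auto
  \<comment> \<open>By minimality of \<open>a\<close>, the point \<open>a - 1\<close> would be
    fixed; strict monotonicity would then give \<open>a - 1 < b\<close>, against
    \<open>b < a\<close>.\<close>
  have notin: "a - 1 \<notin> dom \<alpha>"
  proof
    assume "a - 1 \<in> dom \<alpha>"
    then obtain y where y: "\<alpha> (a - 1) = Some y"
      by blast
    have "\<not> moved (a - 1)"
      using a(2)[of "a - 1"] b(2) by simp
    then have "a - 1 \<le> y"
      using y by (auto simp: moved_def)
    moreover have "y < b"
      using IC_strict_mono[OF IC y b(1)] b(2) by simp
    ultimately show False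
      using b(2) by simp
  qed
  define C where "C = dom \<alpha> - {a}"
  define \<gamma> where "\<gamma> = (\<alpha>(a := None))(a - 1 \<mapsto> b)"
  have \<gamma>_eq: "\<gamma> x = Some y \<longleftrightarrow> x = a - 1 \<and> y = b \<or> x \<noteq> a - 1 \<and> x \<noteq> a \<and> \<alpha> x = Some y" for x y
    by (auto simp: \<gamma>_def)
  have aC: "a \<in> dom \<alpha>" "a \<notin> C"
    using b(1) by (auto simp: C_def)
  have C: "C \<subseteq> {1..n} - {a - 1, a}"
    using IC notin by (auto simp: C_def IC_def)
  have card_C: "card C = p - 1"
    using card_dom fin aC by (simp add: C_def)
  have "\<gamma> \<in> IC n"
  proof (rule IC_I)
    fix x y assume "\<gamma> x = Some y"
    then show "1 \<le> y \<and> y \<le> x \<and> x \<le> n"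
      using IC b bounds unfolding \<gamma>_eq IC_iff by auto
  next
    fix x x' y y'
    assume *: "\<gamma> x = Some y" "\<gamma> x' = Some y'" "x < x'"
    consider "x = a - 1" "x' \<noteq> a - 1" | "x' = a - 1" "x \<noteq> a - 1" | "x \<noteq> a - 1" "x' \<noteq> a - 1"
      using *(3) by blast
    then show "y < y'"
    proof cases
      case 1
      \<comment> \<open>Since \<open>a\<close> is outside the domain of \<open>\<gamma>\<close>, a
        point above \<open>a - 1\<close> is above \<open>a\<close>, so the comparison is inherited
        from \<open>\<alpha>\<close> at \<open>a\<close>.\<close>
      then have "y = b" "\<alpha> x' = Some y'" "a < x'"
        using * by (auto simp: \<gamma>_eq)
      then show ?thesis
        using IC_strict_mono[OF IC b(1)] by blast
    next
      case 2
      then have "y' = b" "\<alpha> x = Some y" "x < a"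
        using * by (auto simp: \<gamma>_eq)
      then show ?thesis
        using IC_strict_mono[OF IC _ b(1)] by blast
    next
      case 3
      then show ?thesis
        using * IC_strict_mono[OF IC] by (auto simp: \<gamma>_eq)
    qed
  qed
  moreover have dom_\<gamma>: "dom \<gamma> = insert (a - 1) C"
    by (auto simp: dom_def \<gamma>_eq C_def)
  moreover have "card (insert (a - 1) C) = p"
    using notin fin card_C assms(3) by (simp add: C_def)
  ultimately have "\<gamma> \<in> ICh n p"
    using IC_card_dom[of \<gamma> n] by (simp add: ICh_def)
  moreover have "\<alpha> = pcomp (lower a C) \<gamma>"
  proof
    fix x
    have "\<alpha> x = Some y \<longleftrightarrow> pcomp (lower a C) \<gamma> x = Some y" for y
      using b notin unfolding pcomp_eq_Some lower_eq_Some \<gamma>_eq C_def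
      by (cases "x = a"; cases "x = a - 1") (auto simp: domIff)
    then show "\<alpha> x = pcomp (lower a C) \<gamma> x"
      by (metis option.exhaust)
  qed
  moreover have "a \<in> {2..n}"
    using b bounds by simp
  ultimately show ?thesis
    using that C card_C dom_\<gamma> ran_lower[OF aC(2)] by metis
qed

section \<open>Counting the maps of displacement at most one\<close>

text \<open>Parameters of the maps of displacement one; \<open>a\<close> starts at \<open>2\<close>
  because its image \<open>a - 1\<close> must be at least \<open>1\<close>.\<close>

definition lower_pairs :: "nat \<Rightarrow> nat \<Rightarrow> (nat \<times> nat set) set" where
  "lower_pairs n p = (SIGMA a:{2..n}. {C. C \<subseteq> {1..n} - {a - 1, a} \<and> card C = p - 1})"

lemma disp_0_eq_image_pid:
  "{\<alpha> \<in> ICh n p. disp \<alpha> = 0} = pid ` {A. A \<subseteq> {1..n} \<and> card A = p}"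
proof (intro subset_antisym subsetI)
  fix \<alpha> assume "\<alpha> \<in> {\<alpha> \<in> ICh n p. disp \<alpha> = 0}"
  then have \<alpha>: "\<alpha> \<in> IC n" "card (dom \<alpha>) = p" "disp \<alpha> = 0"
    using IC_card_dom by (auto simp: ICh_def)
  then have "dom \<alpha> \<subseteq> {1..n}"
    by (simp add: IC_def)
  then show "\<alpha> \<in> pid ` {A. A \<subseteq> {1..n} \<and> card A = p}"
    using disp_eq_0[OF \<alpha>(1,3)] \<alpha>(2) by blast
qed (auto simp: pid_in_ICh disp_pid)

text \<open>Splitting off a \<open>lower\<close> factor uses up the whole displacement, so the
  remaining factor is a partial identity and disappears.\<close>

lemma disp_1_eq_image_lower:
  assumes "1 \<le> p"
  shows "{\<alpha> \<in> ICh n p. disp \<alpha> = 1} = (\<lambda>(a, C). lower a C) ` lower_pairs n p"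
proof (intro subset_antisym subsetI)
  fix \<alpha> assume "\<alpha> \<in> {\<alpha> \<in> ICh n p. disp \<alpha> = 1}"
  then have \<alpha>: "\<alpha> \<in> ICh n p" "disp \<alpha> = 1"
    by auto
  then obtain a C \<gamma> where *: "a \<in> {2..n}" "C \<subseteq> {1..n} - {a - 1, a}" "card C = p - 1"
    "\<gamma> \<in> ICh n p" "ran (lower a C) = dom \<gamma>" "\<alpha> = pcomp (lower a C) \<gamma>"
    using split_off_lower[of \<alpha> n p] assms by auto
  have IC: "lower a C \<in> IC n" "\<gamma> \<in> IC n"
    using lower_in_ICh[OF *(1-3) assms] *(4) by (auto simp: ICh_def)
  have "finite C"
    using *(2) finite_subset by blast
  then have "disp (lower a C) = 1"
    using * by (intro disp_lower) auto
  then have "disp \<gamma> = 0"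
    using disp_pcomp[OF IC *(5)] *(6) \<alpha>(2) by simp
  then have "\<gamma> = pid (ran (lower a C))"
    using disp_eq_0[OF IC(2)] *(5) by metis
  then have "\<alpha> = lower a C"
    using *(6) pcomp_pid_right by metis
  then show "\<alpha> \<in> (\<lambda>(a, C). lower a C) ` lower_pairs n p"
    using * by (auto simp: lower_pairs_def)
next
  fix \<alpha> assume "\<alpha> \<in> (\<lambda>(a, C). lower a C) ` lower_pairs n p"
  then obtain a C where *: "a \<in> {2..n}" "C \<subseteq> {1..n} - {a - 1, a}" "card C = p - 1"
    "\<alpha> = lower a C"
    by (auto simp: lower_pairs_def)
  have "finite C"
    using *(2) finite_subset by blast
  then have "disp \<alpha> = 1"
    unfolding *(4) using * by (intro disp_lower) auto
  then show "\<alpha> \<in> {\<alpha> \<in> ICh n p. disp \<alpha> = 1}"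
    using lower_in_ICh[OF *(1-3) assms] *(4) by simp
qed

lemma inj_on_pid: "inj_on pid X"
  by (metis dom_pid inj_onI)

lemma inj_on_lower: "inj_on (\<lambda>(a, C). lower a C) (lower_pairs n p)"
proof (rule inj_onI, clarify)
  fix a C a' C'
  assume "(a, C) \<in> lower_pairs n p" "(a', C') \<in> lower_pairs n p"
    and eq: "lower a C = lower a' C'"
  then have *: "a \<ge> 2" "a \<notin> C" "a' \<notin> C'"
    by (auto simp: lower_pairs_def)
  \<comment> \<open>As \<open>a \<ge> 2\<close>, the point \<open>a\<close> is really moved, and
    \<open>lower a' C'\<close> can move only \<open>a'\<close>.\<close>
  have "lower a' C' a = Some (a - 1)"
    by (simp add: eq[symmetric] lower_eq_Some)
  then have "a = a'"
    using *(1) by (auto simp: lower_eq_Some)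
  moreover have "insert a C = insert a' C'"
    using eq dom_lower by metis
  ultimately show "a = a' \<and> C = C'"
    using * by auto
qed

lemma finite_lower_pairs: "finite (lower_pairs n p)"
  unfolding lower_pairs_def by (intro finite_SigmaI) auto

text \<open>There are \<open>n - 1\<close> choices of \<open>a\<close>, each leaving
  \<open>n - 2\<close> points for \<open>C\<close>. For \<open>n \<le> 1\<close> both sides are
  \<open>0\<close>, whatever the truncated \<open>n - 2\<close> contributes.\<close>

lemma card_lower_pairs: "card (lower_pairs n p) = (n - 1) * ((n - 2) choose (p - 1))"
proof -
  have "card {C. C \<subseteq> {1..n} - {a - 1, a} \<and> card C = p - 1} = (n - 2) choose (p - 1)"
    if "a \<in> {2..n}" for a
  proof -
    have "card ({1..n} - {a - 1, a}) = n - 2"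
      using that by (subst card_Diff_subset) auto
    then show ?thesis
      by (subst n_subsets) auto
  qed
  then show ?thesis
    unfolding lower_pairs_def by (subst card_SigmaI) auto
qed

lemma card_disp_le_1:
  assumes "1 \<le> p"
  shows "finite {\<alpha> \<in> ICh n p. disp \<alpha> \<le> 1}"
    and "card {\<alpha> \<in> ICh n p. disp \<alpha> \<le> 1} = (n - 1) * ((n - 2) choose (p - 1)) + (n choose p)"
proof -
  let ?D = "\<lambda>k. {\<alpha> \<in> ICh n p. disp \<alpha> = k}"
  have split: "{\<alpha> \<in> ICh n p. disp \<alpha> \<le> 1} = ?D 1 \<union> ?D 0"
    by auto
  have fin: "finite (?D 0)" "finite (?D 1)"
    unfolding disp_0_eq_image_pid disp_1_eq_image_lower[OF assms]
    by (auto simp: finite_lower_pairs)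
  have "card (?D 0) = n choose p"
    unfolding disp_0_eq_image_pid by (simp add: card_image inj_on_pid n_subsets)
  moreover have "card (?D 1) = (n - 1) * ((n - 2) choose (p - 1))"
    unfolding disp_1_eq_image_lower[OF assms]
    by (simp add: card_image inj_on_lower card_lower_pairs)
  ultimately show "card {\<alpha> \<in> ICh n p. disp \<alpha> \<le> 1} =
      (n - 1) * ((n - 2) choose (p - 1)) + (n choose p)"
    unfolding split using fin by (subst card_Un_disjoint) auto
  show "finite {\<alpha> \<in> ICh n p. disp \<alpha> \<le> 1}"
    unfolding split using fin by simp
qed

section \<open>The Rees quotient\<close>

lemma ICh_eq_Diff: "1 \<le> p \<Longrightarrow> ICh n p = K n p - K n (p - 1)"
  by (auto simp: ICh_def K_def)

lemma K_mono: "q \<le> p \<Longrightarrow> K n q \<subseteq> K n p"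
  by (auto simp: K_def)

text \<open>Makes the zero class nonempty even for \<open>p = 1\<close>, and provides a
  representative for computing with it.\<close>

lemma empty_in_K: "Map.empty \<in> K n p"
  by (simp add: K_def IC_iff)

lemma rees_class_outside: "\<alpha> \<in> S - I \<Longrightarrow> rees_cong S I `` {\<alpha>} = {\<alpha>}"
  by (auto simp: rees_cong_def)

lemma rees_class_inside: "\<alpha> \<in> I \<Longrightarrow> I \<subseteq> S \<Longrightarrow> rees_cong S I `` {\<alpha>} = I"
  by (auto simp: rees_cong_def)

lemma rees_quotient_eq:
  assumes "I \<subseteq> S" "I \<noteq> {}"
  shows "rees_quotient S I = insert I ((\<lambda>\<alpha>. {\<alpha>}) ` (S - I))"
proof -
  have "rees_quotient S I = (\<lambda>\<alpha>. rees_cong S I `` {\<alpha>}) ` (I \<union> (S - I))"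
    using assms(1) by (auto simp: rees_quotient_def quotient_def)
  also have "\<dots> = (\<lambda>\<alpha>. I) ` I \<union> (\<lambda>\<alpha>. {\<alpha>}) ` (S - I)"
    unfolding image_Un
    by (intro arg_cong2[where f = "(\<union>)"] image_cong refl
        rees_class_inside[OF _ assms(1)] rees_class_outside)
  finally show ?thesis
    using assms(2) by auto
qed

lemma RIC_eq: "1 \<le> p \<Longrightarrow> RIC n p = insert (K n (p - 1)) ((\<lambda>\<alpha>. {\<alpha>}) ` ICh n p)"
  unfolding RIC_def ICh_eq_Diff using empty_in_K by (intro rees_quotient_eq K_mono) auto

text \<open>Reduces multiplication of nonzero classes to composition of maps, a drop in height
  giving the zero.\<close>

lemma RIC_mult_singletons:
  assumes "1 \<le> p" "\<alpha> \<in> ICh n p" "\<beta> \<in> ICh n p"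
  shows "RIC_mult n p {\<alpha>} {\<beta>} =
    (if pcomp \<alpha> \<beta> \<in> ICh n p then {pcomp \<alpha> \<beta>} else K n (p - 1))"
proof -
  let ?cls = "\<lambda>\<alpha>. rees_cong (K n p) (K n (p - 1)) `` {\<alpha>}"
  have K: "\<alpha> \<in> K n p" "\<beta> \<in> K n p"
    using assms by (auto simp: ICh_eq_Diff)
  then have "pcomp \<alpha> \<beta> \<in> K n p"
    using K_ideal(1)[of \<alpha> n \<beta> p] by (simp add: K_def)
  then have "?cls (pcomp \<alpha> \<beta>) = (if pcomp \<alpha> \<beta> \<in> ICh n p then {pcomp \<alpha> \<beta>} else K n (p - 1))"
    using assms(1) K_mono[of "p - 1" p n]
    by (auto simp: ICh_eq_Diff rees_class_outside rees_class_inside)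
  moreover have "?cls \<alpha> = {\<alpha>}" "?cls \<beta> = {\<beta>}"
    using assms by (simp_all add: ICh_eq_Diff rees_class_outside)
  ultimately show ?thesis
    using RIC_mult_class[OF K] by simp
qed

lemma RIC_mult_zero:
  assumes "1 \<le> p" "X \<in> RIC n p"
  shows "RIC_mult n p (K n (p - 1)) X = K n (p - 1)"
    and "RIC_mult n p X (K n (p - 1)) = K n (p - 1)"
proof -
  let ?I = "K n (p - 1)"
  let ?cls = "\<lambda>\<alpha>. rees_cong (K n p) ?I `` {\<alpha>}"
  have sub: "?I \<subseteq> K n p"
    by (simp add: K_mono)
  obtain \<alpha> where \<alpha>: "\<alpha> \<in> K n p" "X = ?cls \<alpha>"
    using assms(2) by (auto simp: RIC_def rees_quotient_def quotient_def)
  have e: "Map.empty \<in> K n p" "?cls Map.empty = ?I"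
    using empty_in_K rees_class_inside[OF _ sub] by blast+
  have "\<alpha> \<in> IC n"
    using \<alpha>(1) by (simp add: K_def)
  then have "?cls (pcomp Map.empty \<alpha>) = ?I" "?cls (pcomp \<alpha> Map.empty) = ?I"
    using K_ideal[OF _ empty_in_K] rees_class_inside[OF _ sub] by blast+
  then show "RIC_mult n p ?I X = ?I" "RIC_mult n p X ?I = ?I"
    using RIC_mult_class[OF e(1) \<alpha>(1)] RIC_mult_class[OF \<alpha>(1) e(1)] e(2) \<alpha>(2) by simp_all
qed

lemma RIC_mult_closed:
  assumes "1 \<le> p" "X \<in> RIC n p" "Y \<in> RIC n p"
  shows "RIC_mult n p X Y \<in> RIC n p"
  using assms RIC_mult_zero[OF assms(1)] RIC_mult_singletons[OF assms(1)]
  by (auto simp: RIC_eq split: if_splits)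

section \<open>Irreducible elements and generation in the quotient\<close>

lemma singleton_ne_K: "1 \<le> p \<Longrightarrow> \<alpha> \<in> ICh n p \<Longrightarrow> {\<alpha>} \<noteq> K n (p - 1)"
  by (auto simp: ICh_eq_Diff)

text \<open>The zero is absorbing, so a nonzero product has nonzero factors and irreducibility of
  maps carries over to their classes.\<close>

lemma RIC_irreducible_singleton:
  assumes p: "1 \<le> p" and \<alpha>: "\<alpha> \<in> ICh n p" "disp \<alpha> \<le> 1"
    and X: "X \<in> RIC n p" and Y: "Y \<in> RIC n p" and eq: "RIC_mult n p X Y = {\<alpha>}"
  shows "X = {\<alpha>} \<or> Y = {\<alpha>}"
proof -
  note ne = singleton_ne_K[OF p \<alpha>(1)]
  have "X \<noteq> K n (p - 1)" "Y \<noteq> K n (p - 1)"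
    using RIC_mult_zero[OF p] X Y eq ne by metis+
  then obtain \<beta> \<gamma> where *: "X = {\<beta>}" "Y = {\<gamma>}" "\<beta> \<in> ICh n p" "\<gamma> \<in> ICh n p"
    using X Y by (auto simp: RIC_eq[OF p])
  have "\<alpha> = pcomp \<beta> \<gamma>"
    using eq ne unfolding *(1,2) RIC_mult_singletons[OF p *(3,4)] by (auto split: if_splits)
  then show ?thesis
    using disp_le_1_irreducible[OF *(3,4)] \<alpha> *(1,2) by auto
qed

text \<open>Induction on displacement: the \<open>lower\<close> factor takes away exactly
  \<open>1\<close>, so the cofactor is covered by the induction hypothesis.\<close>

lemma singletons_generated:
  assumes p: "1 \<le> p" and G: "(\<lambda>\<alpha>. {\<alpha>}) ` {\<alpha> \<in> ICh n p. disp \<alpha> \<le> 1} \<subseteq> G"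
    and "\<alpha> \<in> ICh n p"
  shows "{\<alpha>} \<in> subsemigroup_gen (RIC_mult n p) G"
  using assms(3)
proof (induction "disp \<alpha>" arbitrary: \<alpha> rule: less_induct)
  case less
  show ?case
  proof (cases "disp \<alpha> \<le> 1")
    case True
    then show ?thesis
      using less.prems G by (intro subsemigroup_gen.base) auto
  next
    case False
    then obtain a C \<gamma> where *: "a \<in> {2..n}" "C \<subseteq> {1..n} - {a - 1, a}" "card C = p - 1"
      "\<gamma> \<in> ICh n p" "ran (lower a C) = dom \<gamma>" "\<alpha> = pcomp (lower a C) \<gamma>"
      using split_off_lower[of \<alpha> n p] less.prems p by auto
    note lw = lower_in_ICh[OF *(1-3) p]
    have "finite C"
      using *(2) finite_subset by blast
    then have d: "disp (lower a C) = 1"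
      using * by (intro disp_lower) auto
    have IC: "lower a C \<in> IC n" "\<gamma> \<in> IC n"
      using lw *(4) by (auto simp: ICh_def)
    have "disp \<gamma> < disp \<alpha>"
      using disp_pcomp[OF IC *(5)] *(6) d by simp
    then have "{\<gamma>} \<in> subsemigroup_gen (RIC_mult n p) G"
      using less.hyps *(4) by blast
    moreover have "{lower a C} \<in> subsemigroup_gen (RIC_mult n p) G"
      using lw d G by (intro subsemigroup_gen.base) auto
    moreover have "RIC_mult n p {lower a C} {\<gamma>} = {\<alpha>}"
      using RIC_mult_singletons[OF p lw *(4)] *(6) less.prems by simp
    ultimately show ?thesis
      using subsemigroup_gen.mult by metis
  qed
qed

text \<open>Only the zero is left over by the preceding lemma; it is assumed here because
  \<open>p < n\<close> and \<open>p = n\<close> provide it differently.\<close>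

lemma generates_RIC:
  assumes p: "1 \<le> p" and G: "(\<lambda>\<alpha>. {\<alpha>}) ` {\<alpha> \<in> ICh n p. disp \<alpha> \<le> 1} \<subseteq> G" "G \<subseteq> RIC n p"
    and zero: "K n (p - 1) \<in> subsemigroup_gen (RIC_mult n p) G"
  shows "subsemigroup_gen (RIC_mult n p) G = RIC n p"
proof
  show "subsemigroup_gen (RIC_mult n p) G \<subseteq> RIC n p"
  proof
    fix X assume "X \<in> subsemigroup_gen (RIC_mult n p) G"
    then show "X \<in> RIC n p"
      by induction (use G(2) RIC_mult_closed[OF p] in auto)
  qed
  show "RIC n p \<subseteq> subsemigroup_gen (RIC_mult n p) G"
    using singletons_generated[OF p G(1)] zero by (auto simp: RIC_eq[OF p])
qed

lemma zero_generated:
  assumes p: "1 \<le> p" "p < n" and G: "(\<lambda>\<alpha>. {\<alpha>}) ` {\<alpha> \<in> ICh n p. disp \<alpha> \<le> 1} \<subseteq> G"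
  shows "K n (p - 1) \<in> subsemigroup_gen (RIC_mult n p) G"
proof -
  \<comment> \<open>Two different sets of size \<open>p\<close>; the second fits into
    \<open>{1..n}\<close> because \<open>p < n\<close>.\<close>
  let ?A = "{1..p}" and ?B = "{2..Suc p}"
  have in_ICh: "pid ?A \<in> ICh n p" "pid ?B \<in> ICh n p"
    using p by (auto intro!: pid_in_ICh)
  have "ran (pid ?A) \<noteq> dom (pid ?B)"
    using p unfolding ran_pid dom_pid by auto
  then have "pcomp (pid ?A) (pid ?B) \<notin> ICh n p"
    using pcomp_in_ICh_iff[OF in_ICh] by simp
  then have "RIC_mult n p {pid ?A} {pid ?B} = K n (p - 1)"
    using RIC_mult_singletons[OF p(1) in_ICh] by simp
  moreover have "{pid ?A} \<in> subsemigroup_gen (RIC_mult n p) G"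
    "{pid ?B} \<in> subsemigroup_gen (RIC_mult n p) G"
    using singletons_generated[OF p(1) G] in_ICh by blast+
  ultimately show ?thesis
    using subsemigroup_gen.mult by metis
qed

text \<open>At height \<open>n\<close> every image and every domain is all of \<open>{1..n}\<close>,
  so nonzero elements always have a nonzero product.\<close>

lemma zero_irreducible:
  assumes n: "1 \<le> n" and X: "X \<in> RIC n n" and Y: "Y \<in> RIC n n"
    and eq: "RIC_mult n n X Y = K n (n - 1)"
  shows "X = K n (n - 1) \<or> Y = K n (n - 1)"
proof (rule ccontr)
  assume "\<not> ?thesis"
  then obtain \<alpha> \<beta> where *: "X = {\<alpha>}" "Y = {\<beta>}" "\<alpha> \<in> ICh n n" "\<beta> \<in> ICh n n"
    using X Y by (auto simp: RIC_eq[OF n])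
  have "ran \<alpha> \<subseteq> {1..n}" "card (ran \<alpha>) = n" "dom \<beta> \<subseteq> {1..n}" "card (dom \<beta>) = n"
    using *(3,4) IC_card_dom by (auto simp: ICh_def IC_def)
  then have "ran \<alpha> = {1..n}" "dom \<beta> = {1..n}"
    by (simp_all add: card_subset_eq)
  then have "pcomp \<alpha> \<beta> \<in> ICh n n"
    using pcomp_in_ICh_iff[OF *(3,4)] by simp
  then show False
    using RIC_mult_singletons[OF n *(3,4)] eq *(1,2) singleton_ne_K[OF n] by auto
qed

text \<open>The cases differ by the zero. For \<open>p = n\<close> the quotient consists of the
  class of the identity and the zero, so its rank is \<open>2\<close>, while the binomial expression
  equals \<open>1\<close>.\<close>

theorem theorem3p13:
  fixes n p :: nat
  assumes "1 \<le> p" and "p \<le> n"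
  shows "(p < n \<longrightarrow>
            semigroup_rank (RIC n p) (RIC_mult n p) = (n - 1) * ((n - 2) choose (p - 1)) + (n choose p)) \<and>
         (p = n \<longrightarrow>
            semigroup_rank (RIC n p) (RIC_mult n p) = (n - 1) * ((n - 2) choose (p - 1)) + (n choose p) + 1)"
proof -
  let ?D = "{\<alpha> \<in> ICh n p. disp \<alpha> \<le> 1}"
  let ?G = "(\<lambda>\<alpha>. {\<alpha>}) ` ?D" and ?I = "K n (p - 1)"
  note D = card_disp_le_1[OF assms(1)]
  have sub: "?G \<subseteq> RIC n p" "?I \<in> RIC n p"
    by (auto simp: RIC_eq[OF assms(1)])
  have fin: "finite ?G"
    using D(1) by simp
  have card_G: "card ?G = (n - 1) * ((n - 2) choose (p - 1)) + (n choose p)"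
    using D(2) by (subst card_image) auto
  have irr: "X = Z \<or> Y = Z"
    if "Z \<in> ?G" "X \<in> RIC n p" "Y \<in> RIC n p" "RIC_mult n p X Y = Z" for X Y Z
    using that RIC_irreducible_singleton[OF assms(1)] by blast
  show ?thesis
  proof (intro conjI impI)
    assume "p < n"
    then have "subsemigroup_gen (RIC_mult n p) ?G = RIC n p"
      using sub assms zero_generated by (intro generates_RIC) auto
    then have "semigroup_rank (RIC n p) (RIC_mult n p) = card ?G"
      using sub fin irr by (intro semigroup_rank_eq_card_irreducibles)
    then show "semigroup_rank (RIC n p) (RIC_mult n p) =
        (n - 1) * ((n - 2) choose (p - 1)) + (n choose p)"
      using card_G by simp
  next
    assume "p = n"
    have "subsemigroup_gen (RIC_mult n p) (insert ?I ?G) = RIC n p"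
      using sub assms by (intro generates_RIC) (auto intro: subsemigroup_gen.base)
    then have "semigroup_rank (RIC n p) (RIC_mult n p) = card (insert ?I ?G)"
    proof (rule semigroup_rank_eq_card_irreducibles[rotated 2])
      fix X Y Z
      assume "Z \<in> insert ?I ?G" "X \<in> RIC n p" "Y \<in> RIC n p" "RIC_mult n p X Y = Z"
      then show "X = Z \<or> Y = Z"
        using irr zero_irreducible[of n X Y] assms(1) \<open>p = n\<close> by blast
    qed (use sub fin in auto)
    \<comment> \<open>The zero class is none of the singletons already counted, which accounts for
      the extra \<open>1\<close>.\<close>
    moreover have "?I \<notin> ?G"
      using singleton_ne_K[OF assms(1)] by blast
    ultimately show "semigroup_rank (RIC n p) (RIC_mult n p) =
        (n - 1) * ((n - 2) choose (p - 1)) + (n choose p) + 1"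
      using card_G fin by simp
  qed
qed

end
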